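(* Let $f=(f_1,\dots,f_m):\mathscr{D}(f)\subseteq\mathbb{R}^n\to\mathbb{R}^m$ and let $C=\bigcap_{i=1}^{k_c}C_i$ be a nonempty intersection of finitely many nonempty closed convex sets $C_i\subseteq\mathbb{R}^n$. Suppose that (i) $\mathscr{D}(f)$ is a nonempty convex set and each $f_i:\mathscr{D}(f)\to\mathbb{R}$ $(i=1,\dots,m)$ is a convex function; (ii) for every $x\in\mathscr{D}(f)$ the Jacobian $f'(x)$ is row bounded below; (iii) $f_i(x)\ge0$ for all $x\in\mathscr{D}(f)$ and $i=1,\dots,m$; and that there exists $x^*$ with $f(x^* )=0$ and $x^*\in C$. Then the iteration sequence $\{x_k\}_{k=0}^\infty$ generated by the APSKM method converges to a solution $x^*$ of the problem "$f(x)=0$ subject to $x\in C$". Moreover, the iteration error satisfies $$\|x_k-x^*\|^2\le\|x_{k-1}-x^*\|^2-\frac{f_{i_k}^2(x_{k-1})}{\|\nabla f_{i_k}(x_{k-1})\|^2},\qquad k=1,2,\dots$$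
   Context: $f$ is differentiable, with Jacobian $f'(x)\in\mathbb{R}^{m\times n}$ whose $i$th row is the gradient $\nabla f_i(x)$ (a row vector). $\|\cdot\|$ is the Euclidean norm, $\|\cdot\|_\infty$ the max norm. $P_X$ is the metric projection onto a closed convex set $X$. Row bounded below: a matrix $A\in\mathbb{R}^{m\times n}$ is row bounded below if there is $\varepsilon>0$ with $\|A(i,:)\|\ge\varepsilon$ for all $1\le i\le m$, where $A(i,:)$ is the $i$th row. APSKM method (accelerated projected sampling Kaczmarz-Motzkin): fix a sample size $\beta\in\{1,\dots,m\}$, a tolerance $\delta>0$ and an initial point $x_0\in\mathscr{D}(f)$. For $k=1,2,\dots$: choose a subset $\tau_k\subseteq\{1,\dots,m\}$ of size $\beta$ uniformly at random (independently at each step); let $i_k\in\arg\max_{i\in\tau_k}|f_i(x_{k-1})|$; set $x_{k-\frac45}=x_{k-1}-\frac{f_{i_k}(x_{k-1})}{\|\nabla f_{i_k}(x_{k-1})\|^2}\nabla f_{i_k}(x_{k-1})^T$; choose two indices $\alpha_1^k,\alpha_2^k$ uniformly at random from $\{1,\dots,k_c\}$; set $x_{k-\frac35}=P_{C_{\alpha_1^k}}(x_{k-\frac45})$ and $x_{k-\frac25}=P_{C_{\alpha_2^k}}(x_{k-\frac35})$. If $\|x_{k-\frac25}-x_{k-\frac35}\|_\infty<\delta$, set $x_k=x_{k-\frac25}$. Otherwise set $x_{k-\frac15}=P_{C_{\alpha_1^k}}(x_{k-\frac25})$, $\lambda_k=\frac{\|x_{k-\frac35}-x_{k-\frac25}\|^2}{\langle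 x_{k-\frac35}-x_{k-\frac15},\,x_{k-\frac35}-x_{k-\frac25}\rangle}$ and $x_k=x_{k-\frac35}+\lambda_k(x_{k-\frac15}-x_{k-\frac35})$. The iterates $x_k$ are understood to be well defined, i.e. to lie in $\mathscr{D}(f)$.
   Formalization: Convergence is proved almost surely, and with two added conditions without which it can fail: the Jacobian f' is continuous on D(f), and the closure of the iterates {x_k} lies in D(f). The error inequality needs neither. *)

theory Defs
  imports "HOL-Analysis.Analysis" "HOL-Probability.Probability"
begin

definition row_bounded_below :: "real ^ 'n ^ 'm \<Rightarrow> bool" where
  "row_bounded_below A \<longleftrightarrow> (\<exists>\<epsilon>>0. \<forall>i. norm (row i A) \<ge> \<epsilon>)"

definition solutions ::
  "(real ^ 'n) set \<Rightarrow> (real ^ 'n \<Rightarrow> real ^ 'm) \<Rightarrow> (nat \<Rightarrow> (real ^ 'n) set) \<Rightarrow> nat \<Rightarrow> (real ^ 'n) set"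
  where "solutions D f C kc = {z \<in> D. f z = 0 \<and> z \<in> (\<Inter>j\<in>{1..kc}. C j)}"

definition kaczmarz_step ::
  "(real ^ 'n \<Rightarrow> real ^ 'm) \<Rightarrow> (real ^ 'n \<Rightarrow> real ^ 'n ^ 'm) \<Rightarrow> 'm \<Rightarrow> real ^ 'n \<Rightarrow> real ^ 'n" where
  "kaczmarz_step f J i x = x - (f x $ i / (norm (row i (J x)))\<^sup>2) *\<^sub>R row i (J x)"

text \<open>In terms of the fractional indices of the method, \<open>y\<close> is the point at \<open>k - 4/5\<close>, and
  \<open>p0\<close>, \<open>p1\<close>, \<open>p2\<close> are the points at \<open>k - 3/5\<close>, \<open>k - 2/5\<close> and \<open>k - 1/5\<close>.\<close>

definition accelerated_projection ::
  "(real ^ 'n) set \<Rightarrow> (real ^ 'n) set \<Rightarrow> real \<Rightarrow> real ^ 'n \<Rightarrow> real ^ 'n" where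
  "accelerated_projection A B \<delta> y =
    (let p0 = closest_point A y; p1 = closest_point B p0
     in if infnorm (p1 - p0) < \<delta> then p1
        else let p2 = closest_point A p1;
                 lam = (norm (p0 - p1))\<^sup>2 / ((p0 - p2) \<bullet> (p0 - p1))
             in p0 + lam *\<^sub>R (p2 - p0))"

text \<open>One realisation of the method. The relation leaves open which maximal index is chosen in
  case of a tie.\<close>

definition apskm_run ::
  "(real ^ 'n \<Rightarrow> real ^ 'm) \<Rightarrow> (real ^ 'n \<Rightarrow> real ^ 'n ^ 'm) \<Rightarrow> (nat \<Rightarrow> (real ^ 'n) set) \<Rightarrow> nat \<Rightarrow>
   nat \<Rightarrow> real \<Rightarrow> real ^ 'n \<Rightarrow>
   (nat \<Rightarrow> 'm set) \<Rightarrow> (nat \<Rightarrow> nat) \<Rightarrow> (nat \<Rightarrow> nat) \<Rightarrow> (nat \<Rightarrow> 'm) \<Rightarrow> (nat \<Rightarrow> real ^ 'n) \<Rightarrow> bool" where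
  "apskm_run f J C kc \<beta> \<delta> x0 \<tau> \<alpha>1 \<alpha>2 i x \<longleftrightarrow>
    x 0 = x0 \<and>
    (\<forall>k\<ge>1. card (\<tau> k) = \<beta> \<and> \<alpha>1 k \<in> {1..kc} \<and> \<alpha>2 k \<in> {1..kc} \<and>
       is_arg_max (\<lambda>j. \<bar>f (x (k - 1)) $ j\<bar>) (\<lambda>j. j \<in> \<tau> k) (i k) \<and>
       x k = accelerated_projection (C (\<alpha>1 k)) (C (\<alpha>2 k)) \<delta> (kaczmarz_step f J (i k) (x (k - 1))))"

text \<open>The triples of choices are independent over the steps. Within a step, the product
  distribution says that the three choices are independent of each other and each is uniform.\<close>

definition apskm_sampling ::
  "'w measure \<Rightarrow> nat \<Rightarrow> nat \<Rightarrow>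
   (nat \<Rightarrow> 'w \<Rightarrow> 'm::finite set) \<Rightarrow> (nat \<Rightarrow> 'w \<Rightarrow> nat) \<Rightarrow> (nat \<Rightarrow> 'w \<Rightarrow> nat) \<Rightarrow> bool" where
  "apskm_sampling M kc \<beta> \<tau> \<alpha>1 \<alpha>2 \<longleftrightarrow>
    prob_space.indep_vars M (\<lambda>_. count_space UNIV) (\<lambda>k \<omega>. (\<tau> k \<omega>, \<alpha>1 k \<omega>, \<alpha>2 k \<omega>)) {1..} \<and>
    (\<forall>k\<ge>1. distr M (count_space UNIV) (\<lambda>\<omega>. (\<tau> k \<omega>, \<alpha>1 k \<omega>, \<alpha>2 k \<omega>)) =
      measure_pmf (pair_pmf (pmf_of_set {T. card T = \<beta>})
        (pair_pmf (pmf_of_set {1..kc}) (pmf_of_set {1..kc}))))"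

end

theory Submission
  imports Defs
begin

text \<open>
  Every step of the method is Fejer monotone: it does not move away from a solution, and what it
  gains controls how much the sets and equations used in that step are violated. Three estimates
  give this. A gradient inequality puts the solution beyond the hyperplane on which the
  linearisation of \<open>f\<^sub>j\<close> vanishes, and since \<open>f\<^sub>j \<ge> 0\<close> the Kaczmarz step moves towards that
  hyperplane without overshooting (\<open>kaczmarz_step_fejer\<close>). A projection gains the squared distance
  it travels. The extrapolation after two projections is long but still gains half of the squared
  distance between the two projected points (\<open>extrapolation_gain\<close>). The claimed error bound
  follows by dropping the gains of the projections.

  Randomness enters only once: almost surely, every admissible triple of choices
  \<open>(\<tau>, \<alpha>1, \<alpha>2)\<close> occurs infinitely often (\<open>AE_iid_pmf_infinitely_often\<close>). From then on the argument
  is deterministic, for one realisation. This matters because ties in the choice of the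
  maximal residual are broken arbitrarily, possibly with knowledge of the future, so the iterates
  need not be measurable and no conditional expectation of the gain is available.

  The deterministic part is \<open>chaotic_fejer_converges\<close>. Give each triple the set of points satisfying
  the equations and constraints that it names. A cluster point \<open>l\<close> of the bounded sequence is not
  left by steps whose set contains \<open>l\<close>. So if some set misses \<open>l\<close>, then from any
  iterate near \<open>l\<close> the sequence stays at least as near until the first step whose set misses \<open>l\<close>.
  As the gains tend to zero, the iterates just before these steps asymptotically
  satisfy the constraints of the step, and hence so does \<open>l\<close>, a contradiction. Thus \<open>l\<close>
  is a solution, and by Fejer monotonicity with respect to \<open>l\<close> the whole sequence converges to it.
  Boundedness of the Jacobian along iterates that approach \<open>l\<close>, which comes from its continuity at
  \<open>l \<in> D\<close>, is what turns short Kaczmarz steps into small residuals.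
\<close>

section \<open>Gain of a single step\<close>

text \<open>The derivative is only taken within \<open>D\<close>, so \<open>y\<close> may lie on the boundary of \<open>D\<close> or \<open>D\<close> may be
  flat. This suffices because only the one-sided derivative along the segment from \<open>y\<close> to
  \<open>z\<close> enters, and its difference quotients are bounded by convexity.\<close>

lemma convex_on_above_tangent:
  fixes g :: "'a::real_normed_vector \<Rightarrow> real"
  assumes g: "convex_on D g" and deriv: "(g has_derivative g') (at y within D)"
    and y: "y \<in> D" and z: "z \<in> D"
  shows "g' (z - y) \<le> g z - g y"
proof -
  define h where "h t = g (y + t *\<^sub>R (z - y))" for t :: real
  have D: "convex D"
    using g by (rule convex_on_imp_convex)
  have seg: "y + t *\<^sub>R (z - y) \<in> D" if "t \<in> {0..1}" for t
  proof -
    have "y + t *\<^sub>R (z - y) = (1 - t) *\<^sub>R y + t *\<^sub>R z"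
      by (simp add: algebra_simps)
    then show ?thesis
      using that D y z by (auto simp: convex_alt)
  qed
  have "((\<lambda>t. y + t *\<^sub>R (z - y)) has_derivative (\<lambda>t. t *\<^sub>R (z - y))) (at 0 within {0..1})"
    by (auto intro!: derivative_eq_intros)
  moreover have "(g has_derivative g')
      (at (y + 0 *\<^sub>R (z - y)) within (\<lambda>t. y + t *\<^sub>R (z - y)) ` {0..1})"
    using deriv seg by (auto intro: has_derivative_subset)
  ultimately have "(h has_derivative (\<lambda>t. g' (t *\<^sub>R (z - y)))) (at 0 within {0..1})"
    unfolding h_def by (rule has_derivative_in_compose)
  moreover have "g' (t *\<^sub>R (z - y)) = g' (z - y) * t" for t
    using deriv by (simp add: has_derivative_def bounded_linear.linear linear_scale)
  ultimately have "(h has_field_derivative g' (z - y)) (at 0 within {0..1})"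
    by (simp add: has_field_derivative_def)
  then have "((\<lambda>t. (h t - h 0) / (t - 0)) \<longlongrightarrow> g' (z - y)) (at 0 within {0..1})"
    by (simp add: has_field_derivative_iff)
  moreover have "eventually (\<lambda>t. (h t - h 0) / (t - 0) \<le> g z - g y) (at 0 within {0..1})"
  proof -
    have "(h t - h 0) / (t - 0) \<le> g z - g y" if t: "t \<in> {0..1}" "t \<noteq> 0" for t
    proof -
      have "h t = g ((1 - t) *\<^sub>R y + t *\<^sub>R z)"
        by (simp add: h_def algebra_simps)
      also have "\<dots> \<le> (1 - t) * g y + t * g z"
        using convex_onD[OF g, of t y z] t y z by simp
      finally show ?thesis
        using t by (simp add: h_def field_simps)
    qed
    then show ?thesis
      by (auto simp: eventually_at_filter)
  qed
  moreover have "at (0::real) within {0..1} \<noteq> bot"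
    by (simp add: trivial_limit_within islimpt_Icc)
  ultimately show ?thesis
    by (rule tendsto_upperbound)
qed

text \<open>With \<open>g\<close> the gradient and \<open>c = f y $ i / g \<bullet> g\<close> the step length, expanding the square gives the
  change \<open>2 * c * (g \<bullet> (z - y)) + c * f y $ i\<close>, and the hypothesis makes the first term
  at most \<open>- 2 * c * f y $ i\<close>. Nonnegativity of \<open>c\<close> is essential here: for a negative residual the
  sublevel set lies on the near side of the hyperplane and the step may overshoot.\<close>

lemma kaczmarz_step_fejer:
  assumes pos: "f y $ i \<ge> 0" and row: "row i (J y) \<noteq> 0"
    and above: "row i (J y) \<bullet> (z - y) \<le> - (f y $ i)"
  shows "(norm (kaczmarz_step f J i y - z))\<^sup>2
    \<le> (norm (y - z))\<^sup>2 - (f y $ i)\<^sup>2 / (norm (row i (J y)))\<^sup>2"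
proof -
  define g where "g = row i (J y)"
  define c where "c = f y $ i / (norm g)\<^sup>2"
  have g: "g \<bullet> g > 0" "(norm g)\<^sup>2 = g \<bullet> g"
    using row by (auto simp: g_def power2_norm_eq_inner)
  have c: "c \<ge> 0" "c * (g \<bullet> g) = f y $ i" "(f y $ i)\<^sup>2 / (norm g)\<^sup>2 = c * f y $ i"
    using pos g by (auto simp: c_def power2_eq_square)
  have "(norm (kaczmarz_step f J i y - z))\<^sup>2 = (norm ((y - z) - c *\<^sub>R g))\<^sup>2"
    by (simp add: kaczmarz_step_def g_def c_def algebra_simps)
  also have "\<dots> = (norm (y - z))\<^sup>2 + 2 * (c * (g \<bullet> (z - y))) + c * (c * (g \<bullet> g))"
    by (simp add: power2_norm_eq_inner inner_diff_left inner_diff_right inner_commute algebra_simps)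
  also have "\<dots> = (norm (y - z))\<^sup>2 + 2 * (c * (g \<bullet> (z - y))) + c * f y $ i"
    by (simp add: c)
  also have "\<dots> \<le> (norm (y - z))\<^sup>2 + 2 * (c * - (f y $ i)) + c * f y $ i"
    using above c by (intro add_mono mult_left_mono) (auto simp: g_def)
  also have "\<dots> = (norm (y - z))\<^sup>2 - (f y $ i)\<^sup>2 / (norm g)\<^sup>2"
    by (simp add: c)
  finally show ?thesis
    by (simp add: g_def)
qed

text \<open>The angle at the projected point is obtuse.\<close>

lemma closest_point_pythagoras:
  fixes y :: "'a::euclidean_space"
  assumes "convex A" "closed A" "z \<in> A"
  shows "(norm (closest_point A y - z))\<^sup>2 + (norm (y - closest_point A y))\<^sup>2 \<le> (norm (y - z))\<^sup>2"
  using closest_point_dot[OF assms, of y]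
  by (simp add: power2_norm_eq_inner inner_diff_left inner_diff_right inner_commute)

text \<open>For \<open>p\<close> in a convex set \<open>A\<close>, \<open>q\<close> its projection onto \<open>B\<close> and \<open>r\<close> the projection of \<open>q\<close> back onto
  \<open>A\<close>, read \<open>P = p - q\<close>, \<open>Q = p - r\<close> and \<open>Z = p - z\<close>. The hypotheses are the obtuse angles at
  \<open>r\<close> seen from \<open>p\<close>, at \<open>r\<close> seen from a common point \<open>z\<close>, and at \<open>q\<close> seen from \<open>z\<close>. The extrapolation
  goes along \<open>r - p\<close> up to the hyperplane that supports \<open>B\<close> at \<open>q\<close>. Its length factor \<open>l\<close> is at
  least 1 but not bounded, so the gain \<open>l * (2 * (Q \<bullet> Z) - l * (Q \<bullet> Q))\<close> has to be
  estimated as a whole. If \<open>Q \<bullet> P = 0\<close> the quotient is 0 by convention, but then \<open>P = 0\<close>.\<close>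

lemma extrapolation_gain:
  fixes P Q Z :: "'a::real_inner"
  assumes 1: "(Q - P) \<bullet> Q \<le> 0" and 2: "(Q - P) \<bullet> (Q - Z) \<le> 0" and 3: "P \<bullet> (P - Z) \<le> 0"
  shows "(norm (Z - ((norm P)\<^sup>2 / (Q \<bullet> P)) *\<^sub>R Q))\<^sup>2 + (norm P)\<^sup>2 / 2 \<le> (norm Z)\<^sup>2"
proof -
  define a b c s where "a = P \<bullet> P" and "b = Q \<bullet> Q" and "c = Q \<bullet> P" and "s = Q \<bullet> Z"
  have a0: "a \<ge> 0" and b0: "b \<ge> 0"
    by (simp_all add: a_def b_def)
  have bc: "b \<le> c"
    using 1 by (simp add: b_def c_def inner_diff_left inner_commute[of P Q])
  have s: "s \<ge> a - c + b"
    using 2 3 by (simp add: a_def b_def c_def s_def inner_diff_left inner_diff_right inner_commute)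
  have cs: "c * c \<le> a * b"
    using Cauchy_Schwarz_ineq[of Q P] by (simp add: a_def b_def c_def power2_eq_square mult.commute)
  show ?thesis
  proof (cases "c = 0")
    case True
    then have "b = 0"
      using bc b0 by simp
    then have "Q = 0"
      by (simp add: b_def)
    then have "a = 0"
      using s True a0 by (simp add: s_def b_def)
    then show ?thesis
      using \<open>Q = 0\<close> by (simp add: a_def)
  next
    case False
    then have c: "c > 0"
      using bc b0 by simp
    have "c * c \<le> a * c"
      using cs mult_left_mono[OF bc a0] by linarith
    then have ca: "c \<le> a"
      using c by simp
    define l where "l = a / c"
    have l: "l \<ge> 1" "l * c = a"
      using ca c by (auto simp: l_def)
    \<comment> \<open>Up to the factor \<open>c\<close> this says \<open>a / 2 \<le> 2 * (a - c + b) - l * b\<close>. It is affine in \<open>b\<close>, and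
      \<open>b\<close> ranges over \<open>c\<^sup>2 / a \<le> b \<le> c\<close>, so the sign of the slope decides which end to check.\<close>
    have "0 \<le> 3 / 2 * (a * c) - 2 * (c * c) + b * (2 * c - a)"
    proof (cases "a \<le> 2 * c")
      case True
      have "(c * c) * (2 * c - a) \<le> a * b * (2 * c - a)"
        using cs True by (intro mult_right_mono) auto
      moreover have "0 \<le> c * (3 * (a - c)\<^sup>2 + c\<^sup>2) / 2"
        using c by simp
      ultimately have "0 \<le> a * (3 / 2 * (a * c) - 2 * (c * c) + b * (2 * c - a))"
        by (simp add: algebra_simps power2_eq_square)
      then show ?thesis
        using c ca by (simp add: zero_le_mult_iff)
    next
      case False
      then have "c * (2 * c - a) \<le> b * (2 * c - a)"
        using bc by (intro mult_right_mono_neg) auto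
      moreover have "0 \<le> a * c"
        using a0 c by simp
      ultimately show ?thesis
        by (simp add: algebra_simps)
    qed
    then have "l * b * c \<le> (2 * (a - c + b) - a / 2) * c"
      using l(2) by (simp add: algebra_simps)
    then have "l * b \<le> 2 * (a - c + b) - a / 2"
      using c by simp
    also have "\<dots> \<le> 2 * s - a / 2"
      using s by simp
    finally have "a / 2 \<le> 2 * s - l * b"
      by simp
    then have "a / 2 \<le> l * (2 * s - l * b)"
      using l a0 mult_mono[of 1 l "a / 2" "2 * s - l * b"] by simp
    moreover have "(norm (Z - l *\<^sub>R Q))\<^sup>2 = (norm Z)\<^sup>2 - l * (2 * s - l * b)"
      by (simp add: power2_norm_eq_inner s_def b_def inner_diff_left inner_diff_right inner_commute
          algebra_simps)
    ultimately show ?thesis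
      by (simp add: l_def a_def c_def power2_norm_eq_inner)
  qed
qed

text \<open>The plain branch gains the whole squared distance between the two projected points. The
  factor one half pays for the extrapolated branch, so one estimate covers every tolerance \<open>\<delta>\<close>.\<close>

lemma accelerated_projection_fejer:
  fixes A B :: "(real ^ 'n) set" and y z :: "real ^ 'n"
  assumes A: "convex A" "closed A" "z \<in> A" and B: "convex B" "closed B" "z \<in> B"
  defines "p \<equiv> closest_point A y"
  shows "(norm (accelerated_projection A B \<delta> y - z))\<^sup>2
    + (norm (y - p))\<^sup>2 + (norm (p - closest_point B p))\<^sup>2 / 2 \<le> (norm (y - z))\<^sup>2"
proof -
  define q where "q = closest_point B p"
  define r where "r = closest_point A q"
  have p: "(norm (p - z))\<^sup>2 + (norm (y - p))\<^sup>2 \<le> (norm (y - z))\<^sup>2"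
    unfolding p_def by (rule closest_point_pythagoras[OF A])
  have "(norm (accelerated_projection A B \<delta> y - z))\<^sup>2 + (norm (p - q))\<^sup>2 / 2 \<le> (norm (p - z))\<^sup>2"
  proof (cases "infnorm (q - p) < \<delta>")
    case True
    have "(norm (q - z))\<^sup>2 + (norm (p - q))\<^sup>2 \<le> (norm (p - z))\<^sup>2"
      unfolding q_def by (rule closest_point_pythagoras[OF B])
    then have "(norm (q - z))\<^sup>2 + (norm (p - q))\<^sup>2 / 2 \<le> (norm (p - z))\<^sup>2"
      using zero_le_power2[of "norm (p - q)"] by linarith
    moreover have "accelerated_projection A B \<delta> y = q"
      using True by (simp add: accelerated_projection_def Let_def p_def q_def)
    ultimately show ?thesis
      by simp
  next
    case False
    have "p \<in> A"
      unfolding p_def using A by (intro closest_point_in_set) auto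
    have "(norm ((p - z) - ((norm (p - q))\<^sup>2 / ((p - r) \<bullet> (p - q))) *\<^sub>R (p - r)))\<^sup>2
        + (norm (p - q))\<^sup>2 / 2 \<le> (norm (p - z))\<^sup>2"
    proof (rule extrapolation_gain)
      show "(p - r - (p - q)) \<bullet> (p - r) \<le> 0"
        using closest_point_dot[OF A(1,2) \<open>p \<in> A\<close>, of q] by (simp add: r_def)
      show "(p - r - (p - q)) \<bullet> (p - r - (p - z)) \<le> 0"
        using closest_point_dot[OF A, of q] by (simp add: r_def)
      show "(p - q) \<bullet> (p - q - (p - z)) \<le> 0"
        using closest_point_dot[OF B, of p] by (simp add: q_def)
    qed
    moreover have "accelerated_projection A B \<delta> y - z
        = (p - z) - ((norm (p - q))\<^sup>2 / ((p - r) \<bullet> (p - q))) *\<^sub>R (p - r)"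
      using False
      by (simp add: accelerated_projection_def Let_def p_def q_def r_def scaleR_diff_right)
    ultimately show ?thesis
      by (simp only:)
  qed
  then show ?thesis
    using p by (simp add: q_def)
qed

section \<open>Fejer monotone sequences under chaotic control\<close>

text \<open>The label \<open>v k\<close> says which set is used in the step from \<open>x k\<close> to \<open>x (Suc k)\<close>. No bound is
  imposed on the gaps between two occurrences of a label, as random choices have none. The last
  hypothesis is where a gain that tends to zero enters in applications.\<close>

lemma chaotic_fejer_converges:
  fixes x :: "nat \<Rightarrow> 'a::heine_borel" and K :: "'v \<Rightarrow> 'a set"
  assumes V: "finite V" "\<And>k. v k \<in> V"
    and often: "\<And>u. u \<in> V \<Longrightarrow> infinite {k. v k = u}"
    and ne: "(\<Inter>u\<in>V. K u) \<noteq> {}"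
    and fejer: "\<And>k z. z \<in> K (v k) \<Longrightarrow> dist (x (Suc k)) z \<le> dist (x k) z"
    and cluster: "\<And>u r l. u \<in> V \<Longrightarrow> filterlim r at_top sequentially \<Longrightarrow> (\<And>n. v (r n) = u) \<Longrightarrow>
      (\<lambda>n. x (r n)) \<longlonglongrightarrow> l \<Longrightarrow> l \<in> K u"
  shows "\<exists>z\<in>(\<Inter>u\<in>V. K u). x \<longlonglongrightarrow> z"
proof -
  have approach: "dist (x n) z \<le> dist (x k) z"
    if "k \<le> n" "\<And>j. k \<le> j \<Longrightarrow> j < n \<Longrightarrow> z \<in> K (v j)" for k n z
    using that by (induction n rule: dec_induct) (auto intro: order_trans[OF fejer])
  obtain z0 where z0: "z0 \<in> (\<Inter>u\<in>V. K u)"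
    using ne by auto
  have "dist z0 (x n) \<le> dist (x 0) z0" for n
    using approach[of 0 n z0] z0 V(2) by (auto simp: dist_commute)
  then have "bounded (range x)"
    unfolding bounded_def by blast
  then obtain l r where r: "strict_mono r" "(x \<circ> r) \<longlonglongrightarrow> l"
    using bounded_imp_convergent_subsequence by blast
  have l: "l \<in> (\<Inter>u\<in>V. K u)"
  proof (rule ccontr)
    assume "l \<notin> (\<Inter>u\<in>V. K u)"
    then obtain u where u: "u \<in> V" "l \<notin> K u"
      by auto
    \<comment> \<open>\<open>m n\<close> is the first step from \<open>r n\<close> on whose set misses \<open>l\<close>; all steps in between
      preserve the distance bound to \<open>l\<close>, so the iterates \<open>x (m n)\<close> tend to \<open>l\<close> as well.\<close>
    define m where "m n = (LEAST k. r n \<le> k \<and> l \<notin> K (v k))" for n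
    have ex: "\<exists>k. r n \<le> k \<and> l \<notin> K (v k)" for n
      using often[OF u(1)] u(2) unfolding infinite_nat_iff_unbounded_le by blast
    have m: "r n \<le> m n" "l \<notin> K (v (m n))" for n
      using LeastI_ex[OF ex[of n]] by (auto simp: m_def)
    have good: "l \<in> K (v j)" if "r n \<le> j" "j < m n" for n j
      using not_less_Least[of j "\<lambda>k. r n \<le> k \<and> l \<notin> K (v k)"] that by (auto simp: m_def)
    have m_closer: "dist (x (m n)) l \<le> dist (x (r n)) l" for n
      using approach[OF m(1)] good by blast
    have "\<forall>\<^sub>F n in sequentially. norm (dist (x (m n)) l) \<le> dist (x (r n)) l"
      using m_closer by simp
    moreover have "(\<lambda>n. dist (x (r n)) l) \<longlonglongrightarrow> 0"
      using r(2) unfolding tendsto_dist_iff[of "x \<circ> r"] by (simp add: o_def)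
    ultimately have "(\<lambda>n. dist (x (m n)) l) \<longlonglongrightarrow> 0"
      by (rule Lim_null_comparison)
    then have xm: "(\<lambda>n. x (m n)) \<longlonglongrightarrow> l"
      by (rule tendsto_dist_iff[THEN iffD2])
    have m_top: "filterlim m at_top sequentially"
      using filterlim_at_top_mono[OF filterlim_subseq[OF r(1)], of m] m(1) by auto
    \<comment> \<open>There are finitely many labels, so one of them is used at infinitely many of the \<open>m n\<close>.\<close>
    have "range (\<lambda>n. v (m n)) \<subseteq> V"
      using V(2) by auto
    then have "finite (range (\<lambda>n. v (m n)))"
      using V(1) finite_subset by blast
    then obtain n0 where n0: "infinite {n \<in> UNIV. v (m n) = v (m n0)}"
      using pigeonhole_infinite[of UNIV "\<lambda>n. v (m n)"] by auto
    define s where "s = enumerate {n \<in> UNIV. v (m n) = v (m n0)}"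
    have s: "strict_mono s" "\<And>n. v (m (s n)) = v (m n0)"
      using strict_mono_enumerate[OF n0] enumerate_in_set[OF n0] by (auto simp: s_def)
    have "l \<in> K (v (m n0))"
    proof (rule cluster)
      show "filterlim (\<lambda>n. m (s n)) at_top sequentially"
        using filterlim_compose[OF m_top filterlim_subseq[OF s(1)]] .
      show "(\<lambda>n. x (m (s n))) \<longlonglongrightarrow> l"
        using LIMSEQ_subseq_LIMSEQ[OF xm s(1)] by (simp add: o_def)
    qed (use s V(2) in auto)
    then show False
      using m(2) by blast
  qed
  have "x \<longlonglongrightarrow> l"
  proof (rule metric_LIMSEQ_I)
    fix e :: real
    assume "e > 0"
    then obtain N where "dist (x (r N)) l < e"
      using metric_LIMSEQ_D[OF r(2)] by (auto simp: o_def)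
    then have "dist (x n) l < e" if "n \<ge> r N" for n
      using approach[OF that, of l] l V(2) by fastforce
    then show "\<exists>no. \<forall>n\<ge>no. dist (x n) l < e"
      by blast
  qed
  with l show ?thesis
    by blast
qed

section \<open>Recurrence of independent choices\<close>

text \<open>The probability of missing \<open>v\<close> in \<open>N + 1\<close> consecutive trials is \<open>(1 - pmf p v) ^ Suc N\<close>,
  which tends to 0. So after any time \<open>v\<close> almost surely occurs again, and there are only countably
  many such times and values in the support.\<close>

lemma (in prob_space) AE_iid_pmf_infinitely_often:
  fixes X :: "nat \<Rightarrow> 'a \<Rightarrow> 'b" and p :: "'b pmf"
  assumes indep: "indep_vars (\<lambda>_. count_space UNIV) X {k0..}"
    and distr: "\<And>k. k \<ge> k0 \<Longrightarrow> distr M (count_space UNIV) (X k) = measure_pmf p"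
  shows "AE \<omega> in M. \<forall>v\<in>set_pmf p. infinite {k. X k \<omega> = v}"
proof (rule AE_ball_countable'[OF _ countable_set_pmf])
  fix v
  assume v: "v \<in> set_pmf p"
  have meas: "X k \<in> measurable M (count_space UNIV)" if "k \<ge> k0" for k
    using indep that by (auto simp: indep_vars_def)
  define miss where "miss k = X k -` (- {v}) \<inter> space M" for k
  have miss: "miss k \<in> events" if "k \<ge> k0" for k
    unfolding miss_def using meas[OF that] by (rule measurable_sets) simp
  have prob_miss: "prob (miss k) = 1 - pmf p v" if "k \<ge> k0" for k
  proof -
    have "prob (miss k) = measure (distr M (count_space UNIV) (X k)) (- {v})"
      unfolding miss_def using meas[OF that] by (subst measure_distr) auto
    also have "\<dots> = 1 - pmf p v"
      using measure_pmf.prob_compl[of "{v}" p] distr[OF that]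
      by (simp add: Compl_eq_Diff_UNIV measure_pmf_single)
    finally show ?thesis .
  qed
  have hit: "AE \<omega> in M. \<exists>k\<ge>n. X k \<omega> = v" for n
  proof -
    define n' where "n' = max n k0"
    define E where "E = (\<Inter>k\<in>{n'..}. miss k)"
    have E: "E \<in> events"
      unfolding E_def using miss by (intro sets.countable_INT') (auto simp: n'_def)
    have "prob E \<le> (1 - pmf p v) ^ Suc N" for N
    proof -
      have "prob E \<le> prob (\<Inter>k\<in>{n'..n'+N}. miss k)"
        using miss by (intro finite_measure_mono sets.finite_INT) (auto simp: E_def n'_def)
      also have "\<dots> = (\<Prod>k\<in>{n'..n'+N}. prob (miss k))"
        unfolding miss_def by (rule indep_varsD[OF indep]) (auto simp: n'_def)
      also have "\<dots> = (1 - pmf p v) ^ Suc N"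
        by (simp add: prob_miss n'_def)
      finally show ?thesis .
    qed
    moreover have "(\<lambda>N. (1 - pmf p v) ^ Suc N) \<longlonglongrightarrow> 0"
      using pmf_positive[OF v] pmf_le_1[of p v] by (intro LIMSEQ_Suc LIMSEQ_power_zero) auto
    ultimately have "prob E \<le> 0"
      by (intro LIMSEQ_le_const) auto
    then have "prob E = 0"
      using measure_nonneg[of M E] by linarith
    then have "AE \<omega> in M. \<omega> \<notin> E"
      using E by (simp add: prob_eq_0)
    then show ?thesis
      using AE_space by eventually_elim (auto simp: E_def miss_def n'_def)
  qed
  have "AE \<omega> in M. \<forall>n. \<exists>k\<ge>n. X k \<omega> = v"
    using hit by (simp add: AE_all_countable)
  then show "AE \<omega> in M. infinite {k. X k \<omega> = v}"
    by (simp add: infinite_nat_iff_unbounded_le)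
qed

section \<open>The accelerated Kaczmarz iteration\<close>

locale nonneg_convex_system =
  fixes D :: "(real ^ 'n) set"
    and f :: "real ^ 'n \<Rightarrow> real ^ 'm"
    and J :: "real ^ 'n \<Rightarrow> real ^ 'n ^ 'm"
  assumes f_convex: "\<And>j. convex_on D (\<lambda>y. f y $ j)"
    and f_deriv: "\<And>y. y \<in> D \<Longrightarrow> (f has_derivative (\<lambda>h. J y *v h)) (at y within D)"
    and J_rows: "\<And>y. y \<in> D \<Longrightarrow> row_bounded_below (J y)"
    and f_nonneg: "\<And>y j. y \<in> D \<Longrightarrow> f y $ j \<ge> 0"
begin

lemma row_nonzero: "y \<in> D \<Longrightarrow> row j (J y) \<noteq> 0"
  using J_rows[of y] by (force simp: row_bounded_below_def dest: spec[of _ j])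

lemma row_inner_le:
  assumes "y \<in> D" "z \<in> D"
  shows "row j (J y) \<bullet> (z - y) \<le> f z $ j - f y $ j"
proof -
  have "((\<lambda>y. f y $ j) has_derivative (\<lambda>h. (J y *v h) $ j)) (at y within D)"
    using bounded_linear.has_derivative[OF bounded_linear_vec_nth f_deriv[OF assms(1)]] .
  from convex_on_above_tangent[OF f_convex this assms] show ?thesis
    by (simp add: matrix_vector_mul_component row_def vec_nth_inverse)
qed

lemma apskm_step_fejer:
  fixes A B :: "(real ^ 'n) set" and y z :: "real ^ 'n"
  assumes y: "y \<in> D" and z: "z \<in> D" "f z $ j = 0"
    and A: "convex A" "closed A" "z \<in> A" and B: "convex B" "closed B" "z \<in> B"
  defines "u \<equiv> kaczmarz_step f J j y"
  defines "p \<equiv> closest_point A u"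
  shows "(norm (accelerated_projection A B \<delta> u - z))\<^sup>2
    + ((f y $ j)\<^sup>2 / (norm (row j (J y)))\<^sup>2
      + (norm (u - p))\<^sup>2 + (norm (p - closest_point B p))\<^sup>2 / 2) \<le> (norm (y - z))\<^sup>2"
proof -
  have "(norm (u - z))\<^sup>2 \<le> (norm (y - z))\<^sup>2 - (f y $ j)\<^sup>2 / (norm (row j (J y)))\<^sup>2"
    unfolding u_def
    using row_inner_le[OF y z(1), of j] z(2)
    by (intro kaczmarz_step_fejer f_nonneg[OF y] row_nonzero[OF y]) simp
  then show ?thesis
    using accelerated_projection_fejer[OF A B, of \<delta> u] by (simp add: p_def)
qed

text \<open>A label is a triple \<open>(T, a, b)\<close> of choices, and its set asks for \<open>f z $ j = 0\<close> for
  all \<open>j \<in> T\<close>, not only for the index that attains the maximal residual: the latter depends on the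
  iterate, so it need not recur, whereas the maximum controls all residuals in \<open>T\<close>.\<close>

lemma apskm_run_converges:
  assumes C: "\<And>j. j \<in> {1..kc} \<Longrightarrow> C j \<noteq> {} \<and> closed (C j) \<and> convex (C j)"
    and solvable: "solutions D f C kc \<noteq> {}"
    and params: "kc \<ge> 1" "\<beta> \<in> {1..CARD('m)}"
    and run: "apskm_run f J C kc \<beta> \<delta> x0 \<tau> \<alpha>1 \<alpha>2 i x"
    and J_cont: "continuous_on D J"
    and in_D: "closure (range x) \<subseteq> D"
    and often: "\<And>T a b. card T = \<beta> \<Longrightarrow> a \<in> {1..kc} \<Longrightarrow> b \<in> {1..kc} \<Longrightarrow>
      infinite {k. (\<tau> k, \<alpha>1 k, \<alpha>2 k) = (T, a, b)}"
  shows "\<exists>z\<in>solutions D f C kc. x \<longlonglongrightarrow> z"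
proof -
  define V where "V = {T :: 'm set. card T = \<beta>} \<times> {1..kc} \<times> {1..kc}"
  \<comment> \<open>Steps are counted from 1 by the method, but labels belong to the iterate that the step leaves.\<close>
  define v where "v k = (\<tau> (Suc k), \<alpha>1 (Suc k), \<alpha>2 (Suc k))" for k
  define K where "K = (\<lambda>(T, a, b). {z \<in> D. (\<forall>j\<in>T. f z $ j = 0) \<and> z \<in> C a \<and> z \<in> C b})"
  define u where "u k = kaczmarz_step f J (i (Suc k)) (x k)" for k
  define p where "p k = closest_point (C (\<alpha>1 (Suc k))) (u k)" for k
  define q where "q k = closest_point (C (\<alpha>2 (Suc k))) (p k)" for k
  define loss where "loss k = (f (x k) $ i (Suc k))\<^sup>2 / (norm (row (i (Suc k)) (J (x k))))\<^sup>2
      + (norm (u k - p k))\<^sup>2 + (norm (p k - q k))\<^sup>2 / 2" for k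
  have xD: "x k \<in> D" for k
    using in_D closure_subset[of "range x"] by auto
  have step: "card (\<tau> (Suc k)) = \<beta>" "\<alpha>1 (Suc k) \<in> {1..kc}" "\<alpha>2 (Suc k) \<in> {1..kc}"
    "i (Suc k) \<in> \<tau> (Suc k)" "\<And>j. j \<in> \<tau> (Suc k) \<Longrightarrow> \<bar>f (x k) $ j\<bar> \<le> \<bar>f (x k) $ i (Suc k)\<bar>"
    "x (Suc k) = accelerated_projection (C (\<alpha>1 (Suc k))) (C (\<alpha>2 (Suc k))) \<delta> (u k)" for k
    using run by (auto simp: apskm_run_def is_arg_max_linorder u_def
        dest!: spec[of _ "Suc k"])
  have V: "finite V" "v k \<in> V" for k
    using step(1-3)[of k] by (simp_all add: V_def v_def)
  have K_eq: "(\<Inter>w\<in>V. K w) = solutions D f C kc"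
  proof (rule set_eqI)
    fix z
    have cover: "\<exists>T :: 'm set. j \<in> T \<and> card T = \<beta>" for j
      using exists_subset_between[of "{j}" \<beta> "UNIV :: 'm set"] params(2) by auto
    show "z \<in> (\<Inter>w\<in>V. K w) \<longleftrightarrow> z \<in> solutions D f C kc"
    proof
      assume z: "z \<in> (\<Inter>w\<in>V. K w)"
      have "z \<in> D \<and> f z $ j = 0 \<and> z \<in> C a" if a: "a \<in> {1..kc}" for j a
      proof -
        obtain T where "j \<in> T" "card T = \<beta>"
          using cover by blast
        then show ?thesis
          using z a by (auto simp: V_def K_def)
      qed
      moreover have "1 \<in> {1..kc}"
        using params(1) by simp
      ultimately show "z \<in> solutions D f C kc"
        unfolding solutions_def vec_eq_iff zero_index by blast
    qed (auto simp: solutions_def V_def K_def)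
  qed
  have fejer: "(norm (x (Suc k) - z))\<^sup>2 + loss k \<le> (norm (x k - z))\<^sup>2" if "z \<in> K (v k)" for k z
    using that step(4)[of k] C[OF step(2)[of k]] C[OF step(3)[of k]]
    unfolding step(6) loss_def q_def p_def u_def
    by (intro apskm_step_fejer xD) (auto simp: K_def v_def)
  have loss_nonneg: "loss k \<ge> 0" for k
    by (simp add: loss_def)
  have loss_0: "loss \<longlonglongrightarrow> 0"
  proof -
    obtain z where z: "z \<in> (\<Inter>w\<in>V. K w)"
      using solvable K_eq by auto
    \<comment> \<open>The squared distances to one fixed solution decrease to a limit and dominate the losses.\<close>
    define d where "d k = (norm (x k - z))\<^sup>2" for k
    have loss_le: "loss k \<le> d k - d (Suc k)" for k
      using fejer[of z k] z V(2)[of k] by (auto simp: d_def)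
    have "decseq d"
      using order_trans[OF loss_nonneg loss_le] by (intro decseq_SucI) simp
    then obtain L where L: "d \<longlonglongrightarrow> L"
      using decseq_convergent[of d 0] by (metis d_def zero_le_power2)
    have "(\<lambda>k. d k - d (Suc k)) \<longlonglongrightarrow> L - L"
      by (intro tendsto_diff L LIMSEQ_Suc)
    then have "(\<lambda>k. d k - d (Suc k)) \<longlonglongrightarrow> 0"
      by simp
    moreover have "\<forall>\<^sub>F k in sequentially. norm (loss k) \<le> d k - d (Suc k)"
      using loss_le loss_nonneg by simp
    ultimately show ?thesis
      by (rule Lim_null_comparison[rotated])
  qed
  have cluster: "l \<in> K w"
    if r: "filterlim r at_top sequentially" and vr: "\<And>n. v (r n) = w"
      and xr: "(\<lambda>n. x (r n)) \<longlonglongrightarrow> l" for w r l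
  proof -
    obtain T a b where w: "w = (T, a, b)"
      by (cases w)
    have ch: "\<tau> (Suc (r n)) = T" "\<alpha>1 (Suc (r n)) = a" "\<alpha>2 (Suc (r n)) = b" for n
      using vr[of n] by (auto simp: v_def w)
    have ab: "a \<in> {1..kc}" "b \<in> {1..kc}"
      using step(2,3)[of "r 0"] by (simp_all add: ch)
    have "l \<in> closure (range x)"
      using xr by (intro closure_sequential[THEN iffD2] exI[of _ "\<lambda>n. x (r n)"]) simp
    then have l: "l \<in> D"
      using in_D by blast
    let ?g = "\<lambda>n. row (i (Suc (r n))) (J (x (r n)))"
    let ?f = "\<lambda>n. f (x (r n)) $ i (Suc (r n))"
    have loss_r: "(\<lambda>n. loss (r n)) \<longlonglongrightarrow> 0"
      using filterlim_compose[OF loss_0 r] .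
    have small: "s \<longlonglongrightarrow> 0" if "\<And>n. (norm (s n))\<^sup>2 \<le> 2 * loss (r n)" for s :: "nat \<Rightarrow> real ^ 'n"
    proof (rule Lim_null_comparison)
      show "\<forall>\<^sub>F n in sequentially. norm (s n) \<le> sqrt (2 * loss (r n))"
        using that by (simp add: real_le_rsqrt)
      show "(\<lambda>n. sqrt (2 * loss (r n))) \<longlonglongrightarrow> 0"
        using tendsto_real_sqrt[OF tendsto_mult_left[OF loss_r, of 2]] by simp
    qed
    have "(\<lambda>n. x (r n) - u (r n)) \<longlonglongrightarrow> 0"
    proof (rule small)
      fix n
      have "(norm (x (r n) - u (r n)))\<^sup>2 = (?f n)\<^sup>2 / (norm (?g n))\<^sup>2"
        by (simp add: u_def kaczmarz_step_def power_divide power2_eq_square)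
      also have "\<dots> \<le> loss (r n)"
        by (simp add: loss_def)
      finally show "(norm (x (r n) - u (r n)))\<^sup>2 \<le> 2 * loss (r n)"
        using loss_nonneg[of "r n"] by linarith
    qed
    from tendsto_diff[OF xr this] have ur: "(\<lambda>n. u (r n)) \<longlonglongrightarrow> l"
      by simp
    have "(\<lambda>n. u (r n) - p (r n)) \<longlonglongrightarrow> 0"
      by (rule small) (simp add: loss_def)
    from tendsto_diff[OF ur this] have pr: "(\<lambda>n. p (r n)) \<longlonglongrightarrow> l"
      by simp
    have "(\<lambda>n. p (r n) - q (r n)) \<longlonglongrightarrow> 0"
      by (rule small) (simp add: loss_def)
    from tendsto_diff[OF pr this] have qr: "(\<lambda>n. q (r n)) \<longlonglongrightarrow> l"
      by simp
    have "p (r n) \<in> C a" "q (r n) \<in> C b" for n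
      using C[OF ab(1)] C[OF ab(2)] by (auto simp: p_def q_def ch intro: closest_point_in_set)
    then have "l \<in> C a" "l \<in> C b"
      using closed_sequentially[OF _ _ pr, of "C a"] closed_sequentially[OF _ _ qr, of "C b"]
        C[OF ab(1)] C[OF ab(2)] by auto
    moreover have "f l $ j = 0" if j: "j \<in> T" for j
    proof -
      \<comment> \<open>The Kaczmarz step has length \<open>\<bar>?f n\<bar> / norm (?g n)\<close>, so a bound on the gradients turns
        short steps into small residuals.\<close>
      have "(\<lambda>n. J (x (r n))) \<longlonglongrightarrow> J l"
        using continuous_on_tendsto_compose[OF J_cont xr l] xD by simp
      then have "Bseq (\<lambda>n. J (x (r n)))"
        by (rule convergent_imp_Bseq[OF convergentI])
      then obtain c where c: "\<And>n. norm (J (x (r n))) \<le> c"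
        by (auto simp: Bseq_def)
      have f_le: "\<bar>f (x (r n)) $ j\<bar> \<le> c * norm (x (r n) - u (r n))" for n
      proof -
        have "\<bar>f (x (r n)) $ j\<bar> \<le> \<bar>?f n\<bar>"
          using step(5)[of j "r n"] j by (simp add: ch)
        also have "\<dots> = norm (?g n) * norm (x (r n) - u (r n))"
          using row_nonzero[OF xD] by (simp add: u_def kaczmarz_step_def power2_eq_square)
        also have "norm (?g n) \<le> norm (J (x (r n)))"
          using Finite_Cartesian_Product.norm_nth_le[of "J (x (r n))" "i (Suc (r n))"] by (simp add: row_def)
        also have "\<dots> \<le> c"
          by (rule c)
        finally show ?thesis
          by (simp add: mult_right_mono)
      qed
      have "(\<lambda>n. c * norm (x (r n) - u (r n))) \<longlonglongrightarrow> c * norm (l - l)"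
        by (intro tendsto_intros xr ur)
      then have "(\<lambda>n. c * norm (x (r n) - u (r n))) \<longlonglongrightarrow> 0"
        by simp
      moreover have "\<forall>\<^sub>F n in sequentially. norm (f (x (r n)) $ j) \<le> c * norm (x (r n) - u (r n))"
        using f_le by simp
      ultimately have "(\<lambda>n. f (x (r n)) $ j) \<longlonglongrightarrow> 0"
        by (rule Lim_null_comparison[rotated])
      moreover have "continuous_on D f"
        using f_deriv by (rule has_derivative_continuous_on)
      then have "(\<lambda>n. f (x (r n)) $ j) \<longlonglongrightarrow> f l $ j"
        using continuous_on_tendsto_compose[OF _ xr l, of f] xD by (intro tendsto_vec_nth) simp
      ultimately show ?thesis
        by (rule LIMSEQ_unique[symmetric])
    qed
    ultimately show ?thesis
      using l by (simp add: K_def w)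
  qed
  have "\<exists>z\<in>(\<Inter>w\<in>V. K w). x \<longlonglongrightarrow> z"
  proof (rule chaotic_fejer_converges[where v = v])
    fix w
    assume "w \<in> V"
    then have inf: "infinite {k. (\<tau> k, \<alpha>1 k, \<alpha>2 k) = w}"
      using often by (auto simp: V_def)
    have "k \<in> {0} \<union> Suc ` {k. v k = w}" if "(\<tau> k, \<alpha>1 k, \<alpha>2 k) = w" for k
      using that by (cases k) (auto simp: v_def)
    then have "{k. (\<tau> k, \<alpha>1 k, \<alpha>2 k) = w} \<subseteq> {0} \<union> Suc ` {k. v k = w}"
      by blast
    then show "infinite {k. v k = w}"
      using inf by (auto dest: finite_subset)
  next
    show "(\<Inter>w\<in>V. K w) \<noteq> {}"
      using solvable by (simp add: K_eq)
  next
    fix k z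
    assume "z \<in> K (v k)"
    from fejer[OF this] loss_nonneg[of k] have "(norm (x (Suc k) - z))\<^sup>2 \<le> (norm (x k - z))\<^sup>2"
      by linarith
    then show "dist (x (Suc k)) z \<le> dist (x k) z"
      by (simp add: dist_norm)
  qed (use V cluster in auto)
  then show ?thesis
    by (simp add: K_eq)
qed

end

theorem theorem7:
  fixes D :: "(real ^ 'n) set"
    and f :: "real ^ 'n \<Rightarrow> real ^ 'm"
    and J :: "real ^ 'n \<Rightarrow> real ^ 'n ^ 'm"
    and C :: "nat \<Rightarrow> (real ^ 'n) set"
    and kc \<beta> :: nat
    and \<delta> :: real
    and x0 :: "real ^ 'n"
    and M :: "'w measure"
    and \<tau> :: "nat \<Rightarrow> 'w \<Rightarrow> 'm set"
    and \<alpha>1 \<alpha>2 :: "nat \<Rightarrow> 'w \<Rightarrow> nat"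
    and i :: "nat \<Rightarrow> 'w \<Rightarrow> 'm"
    and x :: "nat \<Rightarrow> 'w \<Rightarrow> real ^ 'n"
  assumes kc: "kc \<ge> 1"
    and C: "\<And>j. j \<in> {1..kc} \<Longrightarrow> C j \<noteq> {} \<and> closed (C j) \<and> convex (C j)"
    and C_nonempty: "(\<Inter>j\<in>{1..kc}. C j) \<noteq> {}"
    and D: "D \<noteq> {}" "convex D"
    and f_convex: "\<And>j. convex_on D (\<lambda>y. f y $ j)"
    and f_deriv: "\<And>y. y \<in> D \<Longrightarrow> (f has_derivative (\<lambda>h. J y *v h)) (at y within D)"
    and J_rows: "\<And>y. y \<in> D \<Longrightarrow> row_bounded_below (J y)"
    and f_nonneg: "\<And>y j. y \<in> D \<Longrightarrow> f y $ j \<ge> 0"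
    and solvable: "solutions D f C kc \<noteq> {}"
    and params: "\<beta> \<in> {1..CARD('m)}" "\<delta> > 0" "x0 \<in> D"
    and M: "prob_space M"
    and sampling: "apskm_sampling M kc \<beta> \<tau> \<alpha>1 \<alpha>2"
    and run: "\<And>\<omega>. \<omega> \<in> space M \<Longrightarrow>
      apskm_run f J C kc \<beta> \<delta> x0 (\<lambda>k. \<tau> k \<omega>) (\<lambda>k. \<alpha>1 k \<omega>) (\<lambda>k. \<alpha>2 k \<omega>) (\<lambda>k. i k \<omega>) (\<lambda>k. x k \<omega>)"
    and well_defined: "\<And>\<omega> k. \<omega> \<in> space M \<Longrightarrow> x k \<omega> \<in> D"
  shows "(continuous_on D J \<longrightarrow>
           (AE \<omega> in M. closure (range (\<lambda>k. x k \<omega>)) \<subseteq> D \<longrightarrow>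
             (\<exists>z \<in> solutions D f C kc. (\<lambda>k. x k \<omega>) \<longlonglongrightarrow> z))) \<and>
         (\<forall>\<omega> \<in> space M. \<forall>z \<in> solutions D f C kc. \<forall>k\<ge>1.
           (norm (x k \<omega> - z))\<^sup>2 \<le> (norm (x (k - 1) \<omega> - z))\<^sup>2
             - (f (x (k - 1) \<omega>) $ i k \<omega>)\<^sup>2 / (norm (row (i k \<omega>) (J (x (k - 1) \<omega>))))\<^sup>2)"
proof -
  interpret nonneg_convex_system D f J
    using f_convex f_deriv J_rows f_nonneg by unfold_locales
  interpret prob_space M
    by (rule M)
  let ?T = "{T :: 'm set. card T = \<beta>}"
  let ?p = "pair_pmf (pmf_of_set ?T) (pair_pmf (pmf_of_set {1..kc}) (pmf_of_set {1..kc}))"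
  have "?T \<noteq> {}"
    using obtain_subset_with_card_n[of \<beta> "UNIV :: 'm set"] params(1) by auto
  then have set_p: "set_pmf ?p = ?T \<times> {1..kc} \<times> {1..kc}"
    using kc by simp
  have "AE \<omega> in M. \<forall>v\<in>set_pmf ?p. infinite {k. (\<tau> k \<omega>, \<alpha>1 k \<omega>, \<alpha>2 k \<omega>) = v}"
  proof (rule AE_iid_pmf_infinitely_often)
    show "indep_vars (\<lambda>_. count_space UNIV) (\<lambda>k \<omega>. (\<tau> k \<omega>, \<alpha>1 k \<omega>, \<alpha>2 k \<omega>)) {1..}"
      using sampling by (simp only: apskm_sampling_def)
    show "distr M (count_space UNIV) (\<lambda>\<omega>. (\<tau> k \<omega>, \<alpha>1 k \<omega>, \<alpha>2 k \<omega>)) = measure_pmf ?p"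
      if "k \<ge> 1" for k
      using sampling that by (simp only: apskm_sampling_def)
  qed
  then have often: "AE \<omega> in M. \<forall>T a b. card T = \<beta> \<longrightarrow> a \<in> {1..kc} \<longrightarrow> b \<in> {1..kc} \<longrightarrow>
      infinite {k. (\<tau> k \<omega>, \<alpha>1 k \<omega>, \<alpha>2 k \<omega>) = (T, a, b)}"
    unfolding set_p by eventually_elim simp
  show ?thesis
  proof (intro conjI impI ballI allI)
    assume J_cont: "continuous_on D J"
    show "AE \<omega> in M. closure (range (\<lambda>k. x k \<omega>)) \<subseteq> D \<longrightarrow>
        (\<exists>z\<in>solutions D f C kc. (\<lambda>k. x k \<omega>) \<longlonglongrightarrow> z)"
      using often AE_space
    proof eventually_elim
      case (elim \<omega>)
      show ?case
      proof
        assume "closure (range (\<lambda>k. x k \<omega>)) \<subseteq> D"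
        with elim(1) show "\<exists>z\<in>solutions D f C kc. (\<lambda>k. x k \<omega>) \<longlonglongrightarrow> z"
          by (intro apskm_run_converges[OF C solvable kc params(1) run[OF elim(2)] J_cont]) auto
      qed
    qed
  next
    fix \<omega> z k
    assume \<omega>: "\<omega> \<in> space M" and z: "z \<in> solutions D f C kc" and k: "(1::nat) \<le> k"
    have sol: "z \<in> D" "f z $ i k \<omega> = 0" "\<And>j. j \<in> {1..kc} \<Longrightarrow> z \<in> C j"
      using z by (auto simp: solutions_def)
    have \<alpha>: "\<alpha>1 k \<omega> \<in> {1..kc}" "\<alpha>2 k \<omega> \<in> {1..kc}"
      and xk: "x k \<omega> = accelerated_projection (C (\<alpha>1 k \<omega>)) (C (\<alpha>2 k \<omega>)) \<delta>
        (kaczmarz_step f J (i k \<omega>) (x (k - 1) \<omega>))"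
      using run[OF \<omega>] k by (auto simp: apskm_run_def)
    let ?u = "kaczmarz_step f J (i k \<omega>) (x (k - 1) \<omega>)"
    let ?p = "closest_point (C (\<alpha>1 k \<omega>)) ?u"
    have "(norm (x k \<omega> - z))\<^sup>2
        + ((f (x (k - 1) \<omega>) $ i k \<omega>)\<^sup>2 / (norm (row (i k \<omega>) (J (x (k - 1) \<omega>))))\<^sup>2
          + (norm (?u - ?p))\<^sup>2 + (norm (?p - closest_point (C (\<alpha>2 k \<omega>)) ?p))\<^sup>2 / 2)
        \<le> (norm (x (k - 1) \<omega> - z))\<^sup>2"
      unfolding xk
      by (rule apskm_step_fejer) (use well_defined[OF \<omega>] sol C \<alpha> in auto)
    moreover have "0 \<le> (norm (?u - ?p))\<^sup>2"
      "0 \<le> (norm (?p - closest_point (C (\<alpha>2 k \<omega>)) ?p))\<^sup>2 / 2"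
      by simp_all
    ultimately show "(norm (x k \<omega> - z))\<^sup>2 \<le> (norm (x (k - 1) \<omega> - z))\<^sup>2
        - (f (x (k - 1) \<omega>) $ i k \<omega>)\<^sup>2 / (norm (row (i k \<omega>) (J (x (k - 1) \<omega>))))\<^sup>2"
      by linarith
  qed
qed

end
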